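(* Let $\widehat\rho=\ln\rho$ and let $\Omega=\big(\tfrac{2\phi}{W},\tfrac{2\psi}{W},\tfrac{\phi^2+\psi^2-1}{W}\big)$ be the stereographic projection transform, where $W=1+\phi^2+\psi^2$ and $(\phi,\psi)\in\mathbb{R}^2$ (in dimension $n=3$). Then the SOH-NS system $$\begin{cases}\partial_t\rho+\nabla_x\cdot(\rho U)=0,\\ \rho\,\partial_t\Omega+\rho(V\cdot\nabla_x)\Omega+\tfrac{a}{\kappa}P_{\Omega^\perp}\nabla_x\rho=\gamma P_{\Omega^\perp}\Delta_x(\rho\Omega)+\rho P_{\Omega^\perp}\big(\widetilde\lambda S(v)+A(v)\big)\Omega,\\ |\Omega|=1,\\ Re\,(\partial_tv+v\cdot\nabla_xv)+\nabla_xp=\Delta_xv-b\,\nabla_x\cdot\big(\rho\,\mathcal{Q}(\Omega)\big),\\ \nabla_x\cdot v=0\end{cases}$$ can be rewritten as the system $$\begin{cases}\partial_t\widehat\rho+U\cdot\nabla_x\widehat\rho+ac_1(\Omega_\phi\cdot\nabla_x\phi+\Omega_\psi\cdot\nabla_x\psi)=0,\\ \partial_t\phi+V\cdot\nabla_x\phi+\mathcal{H}_\phi=0,\\ \partial_t\psi+V\cdot\nabla_x\psi+\mathcal{H}_\psi=0,\\ Re(\partial_tv+v\cdot\nabla_xv)-\Delta_xv+\nabla_xp+b\,e^{\widehat\rho}\mathcal{G}=0,\\ \nabla_x\cdot v=0,\end{cases}$$ where $\mathcal{H}_\phi,\mathcal{H}_\psi,\mathcal{G}$ are the expressions given in the 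context.
   Context: Unknowns $\rho(t,x)>0$, $\Omega(t,x)\in\mathbb{S}^2$, $v(t,x)\in\mathbb{R}^3$, $p(t,x)\in\mathbb{R}$, and scalar functions $\phi,\psi$ of $(t,x)$, $x\in\mathbb{R}^3$ (smooth enough for the equations to make sense). $a,b,\kappa,\gamma,\widetilde\lambda,c_1,c_2,c_4,Re$ are constant coefficients. $U=ac_1\Omega+v$, $V=ac_2\Omega+v$, $\mathcal{Q}(\Omega)=c_4(\Omega\otimes\Omega-\tfrac13\mathrm{Id})$, $P_{\Omega^\perp}=\mathrm{Id}-\Omega\otimes\Omega$, $(\nabla_xv)_{ij}=\partial_{x_i}v_j$, $S(v)=\tfrac12(\nabla_xv+\nabla_xv^\top)$, $A(v)=\tfrac12(\nabla_xv-\nabla_xv^\top)$; $\Omega_\phi,\Omega_\psi$ are the partial derivatives of $\Omega$ with respect to $\phi,\psi$: $$\Omega_\phi=\big(\tfrac{2(1-\phi^2+\psi^2)}{W^2},-\tfrac{4\phi\psi}{W^2},\tfrac{4\phi}{W^2}\big),\quad\Omega_\psi=\big(-\tfrac{4\phi\psi}{W^2},\tfrac{2(1+\phi^2-\psi^2)}{W^2},\tfrac{4\psi}{W^2}\big).$$ $B:x\otimes y=\sum_{ij}B_{ij}x_iy_j$. Further $$\mathcal{H}_\phi=\tfrac{a}{4\kappa}W^2\Omega_\phi\cdot\nabla_x\widehat\rho-\gamma\Delta_x\phi-2\gamma\nabla_x\widehat\rho\cdot\nabla_x\phi+\tfrac{2\gamma\phi}{W}|\nabla_x\phi|^2+\tfrac{4\gamma\psi}{W}\nabla_x\phi\cdot\nabla_x\psi-\tfrac{2\gamma\phi}{W}|\nabla_x\psi|^2-\tfrac14W^2(\widetilde\lambda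 S(v)+A(v)):\Omega_\phi\otimes\Omega,$$ $$\mathcal{H}_\psi=\tfrac{a}{4\kappa}W^2\Omega_\psi\cdot\nabla_x\widehat\rho-\gamma\Delta_x\psi-2\gamma\nabla_x\widehat\rho\cdot\nabla_x\psi-\tfrac{2\gamma\psi}{W}|\nabla_x\phi|^2+\tfrac{4\gamma\phi}{W}\nabla_x\phi\cdot\nabla_x\psi+\tfrac{2\gamma\psi}{W}|\nabla_x\psi|^2-\tfrac14W^2(\widetilde\lambda S(v)+A(v)):\Omega_\psi\otimes\Omega,$$ $$\mathcal{G}=\nabla_x\widehat\rho\cdot\mathcal{Q}(\Omega)+c_4[(\Omega\cdot\nabla_x\phi)\Omega_\phi+(\Omega\cdot\nabla_x\psi)\Omega_\psi]+c_4(\Omega_\phi\cdot\nabla_x\phi+\Omega_\psi\cdot\nabla_x\psi)\Omega.$$ *)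

theory Defs
  imports "HOL-Analysis.Analysis"
begin

section \<open>Differential operators\<close>

definition px :: "3 \<Rightarrow> (real^3 \<Rightarrow> 'b::real_normed_vector) \<Rightarrow> real^3 \<Rightarrow> 'b" where
  "px i f x = frechet_derivative f (at x) (axis i 1)"

text \<open>The time derivative is taken within the time interval \<open>T\<close>; it is one-sided at an end
  point belonging to \<open>T\<close>.\<close>

definition pt :: "real set \<Rightarrow> (real \<Rightarrow> real^3 \<Rightarrow> 'b::real_normed_vector) \<Rightarrow> real \<Rightarrow> real^3 \<Rightarrow> 'b" where
  "pt T f t x = vector_derivative (\<lambda>s. f s x) (at t within T)"

definition grad :: "(real^3 \<Rightarrow> real) \<Rightarrow> real^3 \<Rightarrow> real^3" where
  "grad f x = (\<chi> i. px i f x)"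

definition dvg :: "(real^3 \<Rightarrow> real^3) \<Rightarrow> real^3 \<Rightarrow> real" where
  "dvg F x = (\<Sum>i\<in>UNIV. px i (\<lambda>y. F y $ i) x)"

text \<open>The divergence of a matrix field contracts the derivative with the first index; it is only
  applied to symmetric fields below.\<close>

definition dvg_mat :: "(real^3 \<Rightarrow> real^3^3) \<Rightarrow> real^3 \<Rightarrow> real^3" where
  "dvg_mat M x = (\<chi> j. \<Sum>i\<in>UNIV. px i (\<lambda>y. M y $ i $ j) x)"

definition lapl :: "(real^3 \<Rightarrow> 'b::real_normed_vector) \<Rightarrow> real^3 \<Rightarrow> 'b" where
  "lapl f x = (\<Sum>i\<in>UNIV. px i (px i f) x)"

text \<open>\<open>advect w f x\<close> is \<open>(w \<cdot> \<nabla>) f\<close> at \<open>x\<close>.\<close>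

definition advect :: "real^3 \<Rightarrow> (real^3 \<Rightarrow> real^3) \<Rightarrow> real^3 \<Rightarrow> real^3" where
  "advect w f x = (\<Sum>i\<in>UNIV. (w $ i) *\<^sub>R px i f x)"

text \<open>\<open>(\<nabla> v)\<^sub>i\<^sub>j = \<partial>\<^sub>i v\<^sub>j\<close>, the transpose of the usual Jacobian matrix.\<close>

definition grad_vec :: "(real^3 \<Rightarrow> real^3) \<Rightarrow> real^3 \<Rightarrow> real^3^3" where
  "grad_vec v x = (\<chi> i j. px i (\<lambda>y. v y $ j) x)"

definition strain :: "(real^3 \<Rightarrow> real^3) \<Rightarrow> real^3 \<Rightarrow> real^3^3" where
  "strain v x = (1/2) *\<^sub>R (grad_vec v x + transpose (grad_vec v x))"

definition spin :: "(real^3 \<Rightarrow> real^3) \<Rightarrow> real^3 \<Rightarrow> real^3^3" where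
  "spin v x = (1/2) *\<^sub>R (grad_vec v x - transpose (grad_vec v x))"

definition twice_differentiable :: "(real^3 \<Rightarrow> 'b::real_normed_vector) \<Rightarrow> bool" where
  "twice_differentiable f \<longleftrightarrow>
     (\<forall>x. f differentiable (at x)) \<and> (\<forall>i x. px i f differentiable (at x))"


section \<open>Algebraic notation\<close>

definition tensor :: "real^3 \<Rightarrow> real^3 \<Rightarrow> real^3^3" where
  "tensor x y = (\<chi> i j. x $ i * y $ j)"

definition contract :: "real^3^3 \<Rightarrow> real^3^3 \<Rightarrow> real" where
  "contract B C = (\<Sum>i\<in>UNIV. \<Sum>j\<in>UNIV. B $ i $ j * C $ i $ j)"

definition proj_perp :: "real^3 \<Rightarrow> real^3^3" where
  "proj_perp w = mat 1 - tensor w w"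

definition Q_tensor :: "real \<Rightarrow> real^3 \<Rightarrow> real^3^3" where
  "Q_tensor c4 w = c4 *\<^sub>R (tensor w w - (1/3) *\<^sub>R mat 1)"

text \<open>\<open>transport a c w u = a c w + u\<close>: the velocity \<open>U\<close> for \<open>c = c1\<close> and \<open>V\<close> for \<open>c = c2\<close>.\<close>

definition transport :: "real \<Rightarrow> real \<Rightarrow> real^3 \<Rightarrow> real^3 \<Rightarrow> real^3" where
  "transport a c w u = (a * c) *\<^sub>R w + u"


section \<open>Stereographic projection transform\<close>

definition stereo_W :: "real \<Rightarrow> real \<Rightarrow> real" where
  "stereo_W f g = 1 + f\<^sup>2 + g\<^sup>2"

definition stereo :: "real \<Rightarrow> real \<Rightarrow> real^3" where
  "stereo f g = vector [2*f / stereo_W f g, 2*g / stereo_W f g, (f\<^sup>2 + g\<^sup>2 - 1) / stereo_W f g]"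

definition stereo_phi :: "real \<Rightarrow> real \<Rightarrow> real^3" where
  "stereo_phi f g = vector
     [2 * (1 - f\<^sup>2 + g\<^sup>2) / (stereo_W f g)\<^sup>2, - (4*f*g / (stereo_W f g)\<^sup>2), 4*f / (stereo_W f g)\<^sup>2]"

definition stereo_psi :: "real \<Rightarrow> real \<Rightarrow> real^3" where
  "stereo_psi f g = vector
     [- (4*f*g / (stereo_W f g)\<^sup>2), 2 * (1 + f\<^sup>2 - g\<^sup>2) / (stereo_W f g)\<^sup>2, 4*g / (stereo_W f g)\<^sup>2]"

lemma stereo_W_pos: "stereo_W f g > 0"
  unfolding stereo_W_def by (smt (verit) zero_le_power2)

lemma has_vector_derivative_vec3:
  fixes F :: "real \<Rightarrow> real^3"
  assumes "((\<lambda>s. F s $ 1) has_real_derivative D $ 1) (at x)"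
    and "((\<lambda>s. F s $ 2) has_real_derivative D $ 2) (at x)"
    and "((\<lambda>s. F s $ 3) has_real_derivative D $ 3) (at x)"
  shows "(F has_vector_derivative D) (at x)"
proof -
  have "((\<lambda>s. F s $ i) has_real_derivative D $ i) (at x)" for i :: 3
    using assms exhaust_3[of i] by auto
  then show ?thesis
    unfolding has_vector_derivative_def has_derivative_componentwise_within[of F]
    by (auto simp: Basis_vec_def inner_axis has_field_derivative_def mult_commute_abs)
qed

lemma stereo_phi_derivative:
  "((\<lambda>f. stereo f g) has_vector_derivative stereo_phi f g) (at f)"
proof -
  have W: "1 + f\<^sup>2 + g\<^sup>2 \<noteq> 0"
    using stereo_W_pos[of f g] by (simp add: stereo_W_def)
  show ?thesis
    unfolding stereo_def stereo_phi_def stereo_W_def using W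
    by (intro has_vector_derivative_vec3;
        auto simp: vector_3 intro!: derivative_eq_intros; simp add: field_simps power2_eq_square)
qed

lemma stereo_psi_derivative:
  "((\<lambda>g. stereo f g) has_vector_derivative stereo_psi f g) (at g)"
proof -
  have W: "1 + f\<^sup>2 + g\<^sup>2 \<noteq> 0"
    using stereo_W_pos[of f g] by (simp add: stereo_W_def)
  show ?thesis
    unfolding stereo_def stereo_psi_def stereo_W_def using W
    by (intro has_vector_derivative_vec3;
        auto simp: vector_3 intro!: derivative_eq_intros; simp add: field_simps power2_eq_square)
qed


section \<open>The SOH-NS system\<close>

definition SOH_NS_solution ::
  "real \<Rightarrow> real \<Rightarrow> real \<Rightarrow> real \<Rightarrow> real \<Rightarrow> real \<Rightarrow> real \<Rightarrow> real \<Rightarrow> real \<Rightarrow> real set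
   \<Rightarrow> (real \<Rightarrow> real^3 \<Rightarrow> real) \<Rightarrow> (real \<Rightarrow> real^3 \<Rightarrow> real^3) \<Rightarrow> (real \<Rightarrow> real^3 \<Rightarrow> real^3)
   \<Rightarrow> (real \<Rightarrow> real^3 \<Rightarrow> real) \<Rightarrow> bool" where
  "SOH_NS_solution a b \<kappa> \<gamma> lam c1 c2 c4 Rey T \<rho> \<Omega> v p \<longleftrightarrow>
    (\<forall>t\<in>T. \<forall>x.
       pt T \<rho> t x + dvg (\<lambda>y. \<rho> t y *\<^sub>R transport a c1 (\<Omega> t y) (v t y)) x = 0
     \<and> \<rho> t x *\<^sub>R pt T \<Omega> t x
         + \<rho> t x *\<^sub>R advect (transport a c2 (\<Omega> t x) (v t x)) (\<Omega> t) x
         + (a / \<kappa>) *\<^sub>R (proj_perp (\<Omega> t x) *v grad (\<rho> t) x)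
       = \<gamma> *\<^sub>R (proj_perp (\<Omega> t x) *v lapl (\<lambda>y. \<rho> t y *\<^sub>R \<Omega> t y) x)
         + \<rho> t x *\<^sub>R (proj_perp (\<Omega> t x) *v
             ((lam *\<^sub>R strain (v t) x + spin (v t) x) *v \<Omega> t x))
     \<and> norm (\<Omega> t x) = 1
     \<and> Rey *\<^sub>R (pt T v t x + advect (v t x) (v t) x) + grad (p t) x
       = lapl (v t) x - b *\<^sub>R dvg_mat (\<lambda>y. \<rho> t y *\<^sub>R Q_tensor c4 (\<Omega> t y)) x
     \<and> dvg (v t) x = 0)"


section \<open>The system in stereographic coordinates\<close>

text \<open>In the next three definitions \<open>rh\<close>, \<open>\<phi>\<close>, \<open>\<psi>\<close> and \<open>v\<close> are the fields at a fixed time.\<close>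

definition H_phi ::
  "real \<Rightarrow> real \<Rightarrow> real \<Rightarrow> real \<Rightarrow> (real^3 \<Rightarrow> real) \<Rightarrow> (real^3 \<Rightarrow> real) \<Rightarrow> (real^3 \<Rightarrow> real)
   \<Rightarrow> (real^3 \<Rightarrow> real^3) \<Rightarrow> real^3 \<Rightarrow> real" where
  "H_phi a \<kappa> \<gamma> lam rh \<phi> \<psi> v x =
    (let W = stereo_W (\<phi> x) (\<psi> x); w = stereo (\<phi> x) (\<psi> x); w\<^sub>\<phi> = stereo_phi (\<phi> x) (\<psi> x) in
       a / (4 * \<kappa>) * W\<^sup>2 * (w\<^sub>\<phi> \<bullet> grad rh x)
     - \<gamma> * lapl \<phi> x
     - 2 * \<gamma> * (grad rh x \<bullet> grad \<phi> x)
     + 2 * \<gamma> * \<phi> x / W * (norm (grad \<phi> x))\<^sup>2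
     + 4 * \<gamma> * \<psi> x / W * (grad \<phi> x \<bullet> grad \<psi> x)
     - 2 * \<gamma> * \<phi> x / W * (norm (grad \<psi> x))\<^sup>2
     - 1/4 * W\<^sup>2 * contract (lam *\<^sub>R strain v x + spin v x) (tensor w\<^sub>\<phi> w))"

definition H_psi ::
  "real \<Rightarrow> real \<Rightarrow> real \<Rightarrow> real \<Rightarrow> (real^3 \<Rightarrow> real) \<Rightarrow> (real^3 \<Rightarrow> real) \<Rightarrow> (real^3 \<Rightarrow> real)
   \<Rightarrow> (real^3 \<Rightarrow> real^3) \<Rightarrow> real^3 \<Rightarrow> real" where
  "H_psi a \<kappa> \<gamma> lam rh \<phi> \<psi> v x =
    (let W = stereo_W (\<phi> x) (\<psi> x); w = stereo (\<phi> x) (\<psi> x); w\<^sub>\<psi> = stereo_psi (\<phi> x) (\<psi> x) in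
       a / (4 * \<kappa>) * W\<^sup>2 * (w\<^sub>\<psi> \<bullet> grad rh x)
     - \<gamma> * lapl \<psi> x
     - 2 * \<gamma> * (grad rh x \<bullet> grad \<psi> x)
     - 2 * \<gamma> * \<psi> x / W * (norm (grad \<phi> x))\<^sup>2
     + 4 * \<gamma> * \<phi> x / W * (grad \<phi> x \<bullet> grad \<psi> x)
     + 2 * \<gamma> * \<psi> x / W * (norm (grad \<psi> x))\<^sup>2
     - 1/4 * W\<^sup>2 * contract (lam *\<^sub>R strain v x + spin v x) (tensor w\<^sub>\<psi> w))"

definition G_vec ::
  "real \<Rightarrow> (real^3 \<Rightarrow> real) \<Rightarrow> (real^3 \<Rightarrow> real) \<Rightarrow> (real^3 \<Rightarrow> real) \<Rightarrow> real^3 \<Rightarrow> real^3" where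
  "G_vec c4 rh \<phi> \<psi> x =
    (let w = stereo (\<phi> x) (\<psi> x);
         w\<^sub>\<phi> = stereo_phi (\<phi> x) (\<psi> x); w\<^sub>\<psi> = stereo_psi (\<phi> x) (\<psi> x) in
       grad rh x v* Q_tensor c4 w
     + c4 *\<^sub>R ((w \<bullet> grad \<phi> x) *\<^sub>R w\<^sub>\<phi> + (w \<bullet> grad \<psi> x) *\<^sub>R w\<^sub>\<psi>)
     + (c4 * (w\<^sub>\<phi> \<bullet> grad \<phi> x + w\<^sub>\<psi> \<bullet> grad \<psi> x)) *\<^sub>R w)"

definition stereo_SOH_NS_solution ::
  "real \<Rightarrow> real \<Rightarrow> real \<Rightarrow> real \<Rightarrow> real \<Rightarrow> real \<Rightarrow> real \<Rightarrow> real \<Rightarrow> real \<Rightarrow> real set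
   \<Rightarrow> (real \<Rightarrow> real^3 \<Rightarrow> real) \<Rightarrow> (real \<Rightarrow> real^3 \<Rightarrow> real) \<Rightarrow> (real \<Rightarrow> real^3 \<Rightarrow> real)
   \<Rightarrow> (real \<Rightarrow> real^3 \<Rightarrow> real^3) \<Rightarrow> (real \<Rightarrow> real^3 \<Rightarrow> real) \<Rightarrow> bool" where
  "stereo_SOH_NS_solution a b \<kappa> \<gamma> lam c1 c2 c4 Rey T rh \<phi> \<psi> v p \<longleftrightarrow>
    (\<forall>t\<in>T. \<forall>x.
      let w = stereo (\<phi> t x) (\<psi> t x);
          w\<^sub>\<phi> = stereo_phi (\<phi> t x) (\<psi> t x); w\<^sub>\<psi> = stereo_psi (\<phi> t x) (\<psi> t x);
          U = transport a c1 w (v t x); V = transport a c2 w (v t x) in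
       pt T rh t x + U \<bullet> grad (rh t) x
         + a * c1 * (w\<^sub>\<phi> \<bullet> grad (\<phi> t) x + w\<^sub>\<psi> \<bullet> grad (\<psi> t) x) = 0
     \<and> pt T \<phi> t x + V \<bullet> grad (\<phi> t) x + H_phi a \<kappa> \<gamma> lam (rh t) (\<phi> t) (\<psi> t) (v t) x = 0
     \<and> pt T \<psi> t x + V \<bullet> grad (\<psi> t) x + H_psi a \<kappa> \<gamma> lam (rh t) (\<phi> t) (\<psi> t) (v t) x = 0
     \<and> Rey *\<^sub>R (pt T v t x + advect (v t x) (v t) x) - lapl (v t) x + grad (p t) x
         + (b * exp (rh t x)) *\<^sub>R G_vec c4 (rh t) (\<phi> t) (\<psi> t) x = 0
     \<and> dvg (v t) x = 0)"

end

theory Submission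
  imports Defs
begin

text \<open>
  The stereographic projection is conformal: \<open>\<Omega>\<^sub>\<phi>\<close>, \<open>\<Omega>\<^sub>\<psi>\<close>, \<open>\<Omega>\<close> is an orthogonal frame in which the
  two tangent vectors have the same length \<open>2 / W\<close>.  Two consequences carry the proof.  The
  projection onto the tangent plane has the closed form
  \<open>P u = W\<^sup>2/4 ((\<Omega>\<^sub>\<phi> \<bullet> u) \<Omega>\<^sub>\<phi> + (\<Omega>\<^sub>\<psi> \<bullet> u) \<Omega>\<^sub>\<psi>)\<close> (lemma \<open>proj_perp_frame\<close>), and the second derivatives of
  \<open>\<Omega>\<close> expand in the frame with the Christoffel symbols of the conformal metric, whose entries are
  \<open>\<plusminus>2\<phi>/W\<close> and \<open>\<plusminus>2\<psi>/W\<close> (lemmas \<open>has_derivative_stereo_phi\<close> and \<open>has_derivative_stereo_psi\<close>).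
  These symbols are the origin of the terms of \<open>\<H>\<^sub>\<phi>\<close> and \<open>\<H>\<^sub>\<psi>\<close> that are quadratic in
  \<open>\<nabla>\<phi>\<close>, \<open>\<nabla>\<psi>\<close>.

  The equations are then compared at one space-time point.  By the chain rule both sides of the
  equation for \<open>\<Omega>\<close> lie in the tangent plane, and their difference is
  \<open>\<rho> (E\<^sub>\<phi> \<Omega>\<^sub>\<phi> + E\<^sub>\<psi> \<Omega>\<^sub>\<psi>)\<close>, where \<open>E\<^sub>\<phi>\<close> and \<open>E\<^sub>\<psi>\<close> are the left-hand sides of the scalar equations
  (lemma \<open>orientation_defect\<close>).  As \<open>\<rho> > 0\<close> and the tangent vectors are independent, the vector
  equation is equivalent to the two scalar ones.  The density equation and the divergence of
  \<open>\<rho> Q(\<Omega>)\<close> each acquire a factor \<open>\<rho>\<close> by the product rule and \<open>\<nabla>\<rho> = \<rho> \<nabla>(ln \<rho>)\<close>; in the former the term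
  \<open>\<rho> (\<nabla> \<bullet> v)\<close> vanishes by incompressibility, which belongs to both systems.
\<close>

section \<open>The stereographic frame\<close>

lemma stereo_W_nonzero: "stereo_W f g \<noteq> 0" "1 + f\<^sup>2 + g\<^sup>2 \<noteq> 0"
  using stereo_W_pos[of f g] by (simp_all add: stereo_W_def)

lemma stereo_frame:
  shows "norm (stereo f g) = 1"
    and "stereo_phi f g \<bullet> stereo_phi f g = 4 / (stereo_W f g)\<^sup>2"
    and "stereo_psi f g \<bullet> stereo_psi f g = 4 / (stereo_W f g)\<^sup>2"
    and "stereo_phi f g \<bullet> stereo_psi f g = 0" "stereo_psi f g \<bullet> stereo_phi f g = 0"
    and "stereo_phi f g \<bullet> stereo f g = 0" "stereo_psi f g \<bullet> stereo f g = 0"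
  unfolding norm_eq_1 stereo_def stereo_phi_def stereo_psi_def inner_vec_def sum_3 stereo_W_def
  using stereo_W_nonzero(2)[of f g] by (simp_all add: divide_simps) algebra+

text \<open>The vectors \<open>W/2 \<Omega>\<^sub>\<phi>\<close>, \<open>W/2 \<Omega>\<^sub>\<psi>\<close>, \<open>\<Omega>\<close> form an orthonormal basis, so that the identity minus the
  projection onto \<open>\<Omega>\<close> is the sum of the projections onto the other two.\<close>

lemma proj_perp_frame:
  "proj_perp (stereo f g) *v u = ((stereo_W f g)\<^sup>2 / 4) *\<^sub>R
     ((stereo_phi f g \<bullet> u) *\<^sub>R stereo_phi f g + (stereo_psi f g \<bullet> u) *\<^sub>R stereo_psi f g)"
  unfolding vec_eq_iff forall_3 proj_perp_def tensor_def mat_def matrix_vector_mult_def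
    stereo_def stereo_phi_def stereo_psi_def inner_vec_def sum_3 stereo_W_def
  using stereo_W_nonzero(2)[of f g] by (simp add: divide_simps) (intro conjI; algebra)

lemma proj_perp_stereo:
  "proj_perp (stereo f g) *v stereo f g = 0"
  "proj_perp (stereo f g) *v stereo_phi f g = stereo_phi f g"
  "proj_perp (stereo f g) *v stereo_psi f g = stereo_psi f g"
  using stereo_W_nonzero[of f g] by (simp_all add: proj_perp_frame stereo_frame)

lemma stereo_frame_independent:
  "c *\<^sub>R stereo_phi f g + d *\<^sub>R stereo_psi f g = 0 \<longleftrightarrow> c = 0 \<and> d = 0" (is "?s = 0 \<longleftrightarrow> _")
proof
  assume "?s = 0"
  then have "stereo_phi f g \<bullet> ?s = 0" "stereo_psi f g \<bullet> ?s = 0"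
    by simp_all
  then show "c = 0 \<and> d = 0"
    using stereo_W_nonzero[of f g] by (simp add: inner_add_right stereo_frame)
qed simp

lemma contract_tensor: "contract M (tensor u w) = u \<bullet> (M *v w)"
  by (simp add: contract_def tensor_def inner_vec_def matrix_vector_mult_def sum_distrib_left mult_ac)


section \<open>Chain rule and Christoffel symbols\<close>

lemma has_derivative_vec3:
  fixes F :: "'a::real_normed_vector \<Rightarrow> real^3"
  assumes "((\<lambda>s. F s $ 1) has_derivative (\<lambda>h. D h $ 1)) (at x within S)"
    and "((\<lambda>s. F s $ 2) has_derivative (\<lambda>h. D h $ 2)) (at x within S)"
    and "((\<lambda>s. F s $ 3) has_derivative (\<lambda>h. D h $ 3)) (at x within S)"
  shows "(F has_derivative D) (at x within S)"
proof -
  have "((\<lambda>s. F s $ i) has_derivative (\<lambda>h. D h $ i)) (at x within S)" for i :: 3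
    using assms exhaust_3[of i] by auto
  then show ?thesis
    unfolding has_derivative_componentwise_within[of F]
    by (auto simp: Basis_vec_def inner_axis)
qed

text \<open>The domain is an arbitrary normed space with a relative derivative: the rules serve for the
  space variable in \<open>\<real>\<^sup>3\<close> as well as for the time variable, whose derivative is one-sided at an
  end point of the time interval.\<close>

context
  fixes f g :: "'a::real_normed_vector \<Rightarrow> real" and f' g' x S
  assumes f_derivative [derivative_intros]: "(f has_derivative f') (at x within S)"
    and g_derivative [derivative_intros]: "(g has_derivative g') (at x within S)"
begin

lemma has_derivative_stereo:
  "((\<lambda>y. stereo (f y) (g y)) has_derivative
      (\<lambda>h. f' h *\<^sub>R stereo_phi (f x) (g x) + g' h *\<^sub>R stereo_psi (f x) (g x))) (at x within S)"
  unfolding stereo_def stereo_phi_def stereo_psi_def stereo_W_def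
  by (rule has_derivative_vec3; simp; (rule derivative_eq_intros refl stereo_W_nonzero(2))+;
      use stereo_W_nonzero(2)[of "f x" "g x"] in \<open>simp add: fun_eq_iff divide_simps\<close>; algebra)

text \<open>In Christoffel symbols: \<open>\<Omega>\<^sub>\<phi>\<^sub>\<phi> = 2/W (- \<phi> \<Omega>\<^sub>\<phi> + \<psi> \<Omega>\<^sub>\<psi>) - 4/W\<^sup>2 \<Omega>\<close> and
  \<open>\<Omega>\<^sub>\<phi>\<^sub>\<psi> = - 2/W (\<psi> \<Omega>\<^sub>\<phi> + \<phi> \<Omega>\<^sub>\<psi>)\<close>.  The tangential parts follow from the conformal factor \<open>4/W\<^sup>2\<close>, the
  normal parts from \<open>\<Omega>\<^sub>\<phi> \<bullet> \<Omega> = 0\<close>.\<close>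

lemma has_derivative_stereo_phi:
  "((\<lambda>y. stereo_phi (f y) (g y)) has_derivative
      (\<lambda>h. (2 / stereo_W (f x) (g x)) *\<^sub>R (
         - (f' h * f x + g' h * g x) *\<^sub>R stereo_phi (f x) (g x)
         + (f' h * g x - g' h * f x) *\<^sub>R stereo_psi (f x) (g x))
         - (4 * f' h / (stereo_W (f x) (g x))\<^sup>2) *\<^sub>R stereo (f x) (g x))) (at x within S)"
proof -
  have W2: "(1 + (f x)\<^sup>2 + (g x)\<^sup>2)\<^sup>2 \<noteq> 0"
    using stereo_W_nonzero(2)[of "f x" "g x"] by simp
  show ?thesis
    unfolding stereo_def stereo_phi_def stereo_psi_def stereo_W_def
    by (rule has_derivative_vec3; simp; (rule derivative_eq_intros refl W2)+;
        use stereo_W_nonzero(2)[of "f x" "g x"] in \<open>simp add: fun_eq_iff divide_simps\<close>; algebra)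
qed

lemma has_derivative_stereo_psi:
  "((\<lambda>y. stereo_psi (f y) (g y)) has_derivative
      (\<lambda>h. (2 / stereo_W (f x) (g x)) *\<^sub>R (
         (g' h * f x - f' h * g x) *\<^sub>R stereo_phi (f x) (g x)
         - (f' h * f x + g' h * g x) *\<^sub>R stereo_psi (f x) (g x))
         - (4 * g' h / (stereo_W (f x) (g x))\<^sup>2) *\<^sub>R stereo (f x) (g x))) (at x within S)"
proof -
  have W2: "(1 + (f x)\<^sup>2 + (g x)\<^sup>2)\<^sup>2 \<noteq> 0"
    using stereo_W_nonzero(2)[of "f x" "g x"] by simp
  show ?thesis
    unfolding stereo_def stereo_phi_def stereo_psi_def stereo_W_def
    by (rule has_derivative_vec3; simp; (rule derivative_eq_intros refl W2)+;
        use stereo_W_nonzero(2)[of "f x" "g x"] in \<open>simp add: fun_eq_iff divide_simps\<close>; algebra)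
qed

end


section \<open>Calculus of the partial derivatives\<close>

lemma px_eqI: "(f has_derivative f') (at x) \<Longrightarrow> px i f x = f' (axis i 1)"
  unfolding px_def using frechet_derivative_at by metis

lemma has_derivative_frechet:
  "f differentiable (at x) \<Longrightarrow> (f has_derivative frechet_derivative f (at x)) (at x)"
  by (simp add: frechet_derivative_works)

lemma px_const: "px i (\<lambda>y. c) x = 0"
  by (subst px_eqI[OF has_derivative_const]) simp

lemma px_add:
  assumes "f differentiable (at x)" "g differentiable (at x)"
  shows "px i (\<lambda>y. f y + g y) x = px i f x + px i g x"
  by (subst px_eqI[OF has_derivative_add[OF assms[THEN has_derivative_frechet]]]) (simp add: px_def)

lemma px_scaleR:
  assumes "f differentiable (at x)" "g differentiable (at x)"
  shows "px i (\<lambda>y. f y *\<^sub>R g y) x = px i f x *\<^sub>R g x + f x *\<^sub>R px i g x"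
  by (subst px_eqI[OF has_derivative_scaleR[OF assms[THEN has_derivative_frechet]]])
    (simp add: px_def)

lemma has_derivative_component:
  assumes "F differentiable (at x)"
  shows "((\<lambda>y. F y $ j) has_derivative (\<lambda>h. frechet_derivative F (at x) h $ j)) (at x)"
  by (rule bounded_linear.has_derivative[OF bounded_linear_vec_nth has_derivative_frechet[OF assms]])

lemma px_component:
  assumes "F differentiable (at x)"
  shows "px i (\<lambda>y. F y $ j) x = px i F x $ j"
  by (subst px_eqI[OF has_derivative_component[OF assms]]) (simp add: px_def)

lemma grad_ln:
  assumes "f differentiable (at x)" "f x > 0"
  shows "grad f x = f x *\<^sub>R grad (\<lambda>y. ln (f y)) x"
proof -
  have "px i (\<lambda>y. ln (f y)) x = px i f x / f x" for i
    by (subst px_eqI[OF has_derivative_ln[where g = f, OF assms(2) has_derivative_frechet[OF assms(1)]]])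
      (simp add: px_def field_simps)
  then show ?thesis
    using assms(2) by (simp add: grad_def vec_eq_iff)
qed

context
  fixes f g :: "real^3 \<Rightarrow> real" and x
  assumes fg: "f differentiable (at x)" "g differentiable (at x)"
begin

lemma px_stereo:
  "px i (\<lambda>y. stereo (f y) (g y)) x
     = px i f x *\<^sub>R stereo_phi (f x) (g x) + px i g x *\<^sub>R stereo_psi (f x) (g x)"
  by (subst px_eqI[OF has_derivative_stereo[OF fg[THEN has_derivative_frechet]]]) (simp add: px_def)

lemma px_stereo_phi:
  "px i (\<lambda>y. stereo_phi (f y) (g y)) x
     = (2 / stereo_W (f x) (g x)) *\<^sub>R (
         - (px i f x * f x + px i g x * g x) *\<^sub>R stereo_phi (f x) (g x)
         + (px i f x * g x - px i g x * f x) *\<^sub>R stereo_psi (f x) (g x))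
         - (4 * px i f x / (stereo_W (f x) (g x))\<^sup>2) *\<^sub>R stereo (f x) (g x)"
  by (subst px_eqI[OF has_derivative_stereo_phi[OF fg[THEN has_derivative_frechet]]])
    (simp add: px_def)

lemma px_stereo_psi:
  "px i (\<lambda>y. stereo_psi (f y) (g y)) x
     = (2 / stereo_W (f x) (g x)) *\<^sub>R (
         (px i g x * f x - px i f x * g x) *\<^sub>R stereo_phi (f x) (g x)
         - (px i f x * f x + px i g x * g x) *\<^sub>R stereo_psi (f x) (g x))
         - (4 * px i g x / (stereo_W (f x) (g x))\<^sup>2) *\<^sub>R stereo (f x) (g x)"
  by (subst px_eqI[OF has_derivative_stereo_psi[OF fg[THEN has_derivative_frechet]]])
    (simp add: px_def)

lemma differentiable_stereo:
  "(\<lambda>y. stereo (f y) (g y)) differentiable (at x)"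
  "(\<lambda>y. stereo_phi (f y) (g y)) differentiable (at x)"
  "(\<lambda>y. stereo_psi (f y) (g y)) differentiable (at x)"
  using fg[THEN has_derivative_frechet] has_derivative_stereo has_derivative_stereo_phi
    has_derivative_stereo_psi
  unfolding differentiable_def by blast+

lemma advect_stereo:
  "advect V (\<lambda>y. stereo (f y) (g y)) x
     = (V \<bullet> grad f x) *\<^sub>R stereo_phi (f x) (g x) + (V \<bullet> grad g x) *\<^sub>R stereo_psi (f x) (g x)"
  unfolding advect_def px_stereo inner_vec_def grad_def
  by (simp add: scaleR_add_right sum.distrib scaleR_sum_left)

end

lemma twice_differentiableD:
  assumes "twice_differentiable f"
  shows "f differentiable (at x)" "px i f differentiable (at x)"
  using assms by (auto simp: twice_differentiable_def)

lemma twice_differentiable_stereo: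
  assumes f: "twice_differentiable f" and g: "twice_differentiable g"
  shows "twice_differentiable (\<lambda>y. stereo (f y) (g y))"
proof -
  note d = f[THEN twice_differentiableD(1)] g[THEN twice_differentiableD(1)]
    f[THEN twice_differentiableD(2)] g[THEN twice_differentiableD(2)]
  show ?thesis
    unfolding twice_differentiable_def
    by (auto simp: px_stereo[OF d(1,2), abs_def] differentiable_stereo d
        intro!: differentiable_add differentiable_scaleR)
qed

text \<open>The deviation of \<open>\<Delta>\<Omega>\<close> from \<open>\<Delta>\<phi> \<Omega>\<^sub>\<phi> + \<Delta>\<psi> \<Omega>\<^sub>\<psi>\<close> consists of the tension term, which contracts the
  Christoffel symbols with the gradients, and of a normal term that the projection removes.\<close>

lemma lapl_stereo:
  assumes f: "twice_differentiable f" and g: "twice_differentiable g"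
  shows "lapl (\<lambda>y. stereo (f y) (g y)) x =
     (lapl f x + (2 / stereo_W (f x) (g x)) * (- f x * (norm (grad f x))\<^sup>2
         - 2 * g x * (grad f x \<bullet> grad g x) + f x * (norm (grad g x))\<^sup>2)) *\<^sub>R stereo_phi (f x) (g x)
   + (lapl g x + (2 / stereo_W (f x) (g x)) * (g x * (norm (grad f x))\<^sup>2
         - 2 * f x * (grad f x \<bullet> grad g x) - g x * (norm (grad g x))\<^sup>2)) *\<^sub>R stereo_psi (f x) (g x)
   - (4 / (stereo_W (f x) (g x))\<^sup>2 * ((norm (grad f x))\<^sup>2 + (norm (grad g x))\<^sup>2))
       *\<^sub>R stereo (f x) (g x)"
proof -
  note d = f[THEN twice_differentiableD(1)] g[THEN twice_differentiableD(1)]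
    f[THEN twice_differentiableD(2)] g[THEN twice_differentiableD(2)]
  have second: "px i (px i (\<lambda>y. stereo (f y) (g y))) x =
      px i (px i f) x *\<^sub>R stereo_phi (f x) (g x) + px i f x *\<^sub>R px i (\<lambda>y. stereo_phi (f y) (g y)) x
    + (px i (px i g) x *\<^sub>R stereo_psi (f x) (g x)
       + px i g x *\<^sub>R px i (\<lambda>y. stereo_psi (f y) (g y)) x)" for i
    by (simp add: px_stereo[OF d(1,2), abs_def] px_add px_scaleR differentiable_stereo d)
  show ?thesis
    unfolding lapl_def second px_stereo_phi[OF d(1,2)] px_stereo_psi[OF d(1,2)]
      dot_square_norm[symmetric] inner_vec_def grad_def sum_3
    by (simp add: vec_eq_iff algebra_simps add_divide_distrib diff_divide_distrib power2_eq_square)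
qed

lemma lapl_scaleR:
  assumes r: "twice_differentiable r" and F: "twice_differentiable F"
  shows "lapl (\<lambda>y. r y *\<^sub>R F y) x
    = lapl r x *\<^sub>R F x + 2 *\<^sub>R (\<Sum>i\<in>UNIV. px i r x *\<^sub>R px i F x) + r x *\<^sub>R lapl F x"
proof -
  note d = r[THEN twice_differentiableD(1)] F[THEN twice_differentiableD(1)]
    r[THEN twice_differentiableD(2)] F[THEN twice_differentiableD(2)]
  have "px i (px i (\<lambda>y. r y *\<^sub>R F y)) x =
      px i (px i r) x *\<^sub>R F x + 2 *\<^sub>R (px i r x *\<^sub>R px i F x) + r x *\<^sub>R px i (px i F) x" for i
    unfolding scaleR_2
    by (simp add: px_scaleR[OF d(1,2), abs_def] px_add px_scaleR differentiable_scaleR d)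
  then show ?thesis
    by (simp add: lapl_def sum.distrib scaleR_sum_left scaleR_sum_right)
qed


section \<open>The equations at a fixed time\<close>

text \<open>In the three lemmas below \<open>rh\<close> enters only through its gradient at one point, so the relation
  between \<open>\<rho>\<close> and its logarithm is required in the form \<open>\<nabla>\<rho> = \<rho> \<nabla>rh\<close>.  The numbers \<open>ft\<close>, \<open>gt\<close> stand
  for the time derivatives of \<open>\<phi>\<close>, \<open>\<psi>\<close>.

  The projection removes the normal component \<open>(\<Delta>\<rho>) \<Omega>\<close> of \<open>\<Delta>(\<rho>\<Omega>)\<close> and leaves
  \<open>2 (\<nabla>\<rho> \<bullet> \<nabla>)\<Omega> + \<rho> P \<Delta>\<Omega>\<close>, which the chain rule expresses in the frame.  In the pressure term
  \<open>P \<nabla>\<rho>\<close> and the flow alignment term \<open>P (\<dots>) \<Omega>\<close> the projected vectors are arbitrary; their expansion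
  by \<open>proj_perp_frame\<close> produces the factors \<open>W\<^sup>2/4\<close>.\<close>

lemma orientation_defect:
  fixes r rh f g :: "real^3 \<Rightarrow> real" and v :: "real^3 \<Rightarrow> real^3"
  assumes r: "twice_differentiable r" and f: "twice_differentiable f" and g: "twice_differentiable g"
    and grad_r: "grad r x = r x *\<^sub>R grad rh x"
  shows "r x *\<^sub>R (ft *\<^sub>R stereo_phi (f x) (g x) + gt *\<^sub>R stereo_psi (f x) (g x))
      + r x *\<^sub>R advect V (\<lambda>y. stereo (f y) (g y)) x
      + (a / \<kappa>) *\<^sub>R (proj_perp (stereo (f x) (g x)) *v grad r x)
      - (\<gamma> *\<^sub>R (proj_perp (stereo (f x) (g x)) *v lapl (\<lambda>y. r y *\<^sub>R stereo (f y) (g y)) x)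
         + r x *\<^sub>R (proj_perp (stereo (f x) (g x)) *v
             ((lam *\<^sub>R strain v x + spin v x) *v stereo (f x) (g x))))
    = r x *\<^sub>R ((ft + V \<bullet> grad f x + H_phi a \<kappa> \<gamma> lam rh f g v x) *\<^sub>R stereo_phi (f x) (g x)
            + (gt + V \<bullet> grad g x + H_psi a \<kappa> \<gamma> lam rh f g v x) *\<^sub>R stereo_psi (f x) (g x))"
proof -
  note d = f[THEN twice_differentiableD(1)] g[THEN twice_differentiableD(1)]
  define P where "P = (*v) (proj_perp (stereo (f x) (g x)))"
  define M where "M = lam *\<^sub>R strain v x + spin v x"
  have linear_P: "linear P"
    unfolding P_def by simp
  have cross: "(\<Sum>i\<in>UNIV. px i r x *\<^sub>R px i (\<lambda>y. stereo (f y) (g y)) x)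
      = advect (r x *\<^sub>R grad rh x) (\<lambda>y. stereo (f y) (g y)) x"
    unfolding advect_def grad_r[symmetric] by (simp add: grad_def)
  have diffusion: "P (lapl (\<lambda>y. r y *\<^sub>R stereo (f y) (g y)) x) = r x *\<^sub>R (
     ((lapl f x + (2 / stereo_W (f x) (g x)) * (- f x * (norm (grad f x))\<^sup>2
         - 2 * g x * (grad f x \<bullet> grad g x) + f x * (norm (grad g x))\<^sup>2))
       + 2 * (grad rh x \<bullet> grad f x)) *\<^sub>R stereo_phi (f x) (g x)
   + ((lapl g x + (2 / stereo_W (f x) (g x)) * (g x * (norm (grad f x))\<^sup>2
         - 2 * f x * (grad f x \<bullet> grad g x) - g x * (norm (grad g x))\<^sup>2))
       + 2 * (grad rh x \<bullet> grad g x)) *\<^sub>R stereo_psi (f x) (g x))"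
    unfolding lapl_scaleR[OF r twice_differentiable_stereo[OF f g]] cross lapl_stereo[OF f g]
      advect_stereo[OF d] linear_add[OF linear_P] linear_diff[OF linear_P] linear_scale[OF linear_P]
    unfolding P_def proj_perp_stereo
    by (simp add: algebra_simps)
  have P_frame: "P u = ((stereo_W (f x) (g x))\<^sup>2 / 4) *\<^sub>R
     ((stereo_phi (f x) (g x) \<bullet> u) *\<^sub>R stereo_phi (f x) (g x)
      + (stereo_psi (f x) (g x) \<bullet> u) *\<^sub>R stereo_psi (f x) (g x))" for u
    unfolding P_def by (rule proj_perp_frame)
  show ?thesis
    \<comment> \<open>The diffusion term is replaced before \<open>P\<close> is expanded, as the frame formula would hide
      that its normal part vanishes.\<close>
    unfolding P_def[symmetric] M_def[symmetric] diffusion grad_r advect_stereo[OF d]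
      H_phi_def H_psi_def Let_def contract_tensor
    unfolding P_frame by (simp add: algebra_simps add_divide_distrib diff_divide_distrib)
qed

lemma dvg_mass_flux:
  fixes r rh f g :: "real^3 \<Rightarrow> real" and v :: "real^3 \<Rightarrow> real^3"
  assumes r: "r differentiable (at x)" and fg: "f differentiable (at x)" "g differentiable (at x)"
    and v: "v differentiable (at x)"
    and grad_r: "grad r x = r x *\<^sub>R grad rh x"
  shows "dvg (\<lambda>y. r y *\<^sub>R transport a c (stereo (f y) (g y)) (v y)) x
    = r x * (transport a c (stereo (f x) (g x)) (v x) \<bullet> grad rh x
        + a * c * (stereo_phi (f x) (g x) \<bullet> grad f x + stereo_psi (f x) (g x) \<bullet> grad g x)
        + dvg v x)"
proof -
  have px_r: "px i r x = r x * px i rh x" for i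
    using grad_r by (simp add: grad_def vec_eq_iff)
  have U: "(\<lambda>y. transport a c (stereo (f y) (g y)) (v y)) differentiable (at x)"
    unfolding transport_def
    by (intro differentiable_add differentiable_scaleR differentiable_const differentiable_stereo fg v)
  have px_U: "px i (\<lambda>y. transport a c (stereo (f y) (g y)) (v y)) x =
     (a * c) *\<^sub>R (px i f x *\<^sub>R stereo_phi (f x) (g x) + px i g x *\<^sub>R stereo_psi (f x) (g x))
     + px i v x" for i
    unfolding transport_def
    by (simp add: px_add px_scaleR differentiable_stereo fg v px_stereo px_const
        differentiable_scaleR)
  show ?thesis
    unfolding dvg_def
    by (simp only: px_component px_component[OF v] px_scaleR r U differentiable_scaleR px_U px_r)
      (simp add: inner_vec_def sum_3 grad_def algebra_simps)
qed

text \<open>The constant isotropic part of \<open>Q\<close> contributes only through \<open>\<nabla>\<rho>\<close>, while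
  \<open>\<nabla> \<bullet> (\<Omega> \<otimes> \<Omega>) = (\<Omega> \<bullet> \<nabla>)\<Omega> + (\<nabla> \<bullet> \<Omega>) \<Omega>\<close> gives the two groups of terms with the factor \<open>c\<close> in
  \<open>G_vec\<close>.\<close>

lemma dvg_mat_Q_tensor:
  fixes r rh f g :: "real^3 \<Rightarrow> real"
  assumes r: "r differentiable (at x)" and fg: "f differentiable (at x)" "g differentiable (at x)"
    and grad_r: "grad r x = r x *\<^sub>R grad rh x"
  shows "dvg_mat (\<lambda>y. r y *\<^sub>R Q_tensor c (stereo (f y) (g y))) x = r x *\<^sub>R G_vec c rh f g x"
proof -
  let ?w = "\<lambda>y. stereo (f y) (g y)"
  have px_r: "px i r x = r x * px i rh x" for i
    using grad_r by (simp add: grad_def vec_eq_iff)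
  have "px i (\<lambda>y. r y * (c * (?w y $ i * ?w y $ j - k))) x
      = px i r x * (c * (?w x $ i * ?w x $ j - k))
        + r x * (c * (px i ?w x $ i * ?w x $ j + ?w x $ i * px i ?w x $ j))" for i j k
    by (subst px_eqI, (rule derivative_eq_intros has_derivative_frechet[OF r]
          has_derivative_component[OF differentiable_stereo(1)[OF fg]] refl)+)
      (simp add: px_def algebra_simps)
  then have "px i (\<lambda>y. (r y *\<^sub>R Q_tensor c (?w y)) $ i $ j) x
      = px i r x * Q_tensor c (?w x) $ i $ j
        + r x * (c * (px i ?w x $ i * ?w x $ j + ?w x $ i * px i ?w x $ j))" for i j
    by (simp add: Q_tensor_def tensor_def mult.assoc)
  then show ?thesis
    unfolding dvg_mat_def G_vec_def Let_def px_stereo[OF fg] px_r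
    by (simp add: vec_eq_iff vector_matrix_mult_def inner_vec_def sum_3 grad_def algebra_simps)
qed


section \<open>Time derivatives\<close>

text \<open>A nondegenerate interval has no isolated points, so its relative derivatives are unique.\<close>

lemma pt_eqI:
  assumes "is_interval T" "interior T \<noteq> {}" "t \<in> T"
    and "((\<lambda>s. F s x) has_vector_derivative D) (at t within T)"
  shows "pt T F t x = D"
proof -
  have "T \<noteq> {t}"
    using assms(2) by auto
  then have "t islimpt T"
    using assms(1,3) connected_imp_perfect is_interval_connected by blast
  then show ?thesis
    unfolding pt_def using assms(4)
    by (auto intro!: vector_derivative_within simp: trivial_limit_within)
qed

lemma has_vector_derivative_pt:
  assumes "(\<lambda>s. F s x) differentiable (at t within T)"
  shows "((\<lambda>s. F s x) has_vector_derivative pt T F t x) (at t within T)"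
  unfolding pt_def using assms by (simp add: vector_derivative_works)

lemma pt_ln:
  fixes r rh :: "real \<Rightarrow> real^3 \<Rightarrow> real"
  assumes T: "is_interval T" "interior T \<noteq> {}" "t \<in> T"
    and r: "(\<lambda>s. r s x) differentiable (at t within T)" "r t x > 0"
    and rh: "\<And>s. s \<in> T \<Longrightarrow> rh s x = ln (r s x)"
  shows "pt T r t x = r t x * pt T rh t x"
proof -
  have "((\<lambda>s. rh s x) has_vector_derivative pt T r t x / r t x) (at t within T)"
  proof (rule has_vector_derivative_transform[OF T(3)])
    show "((\<lambda>s. ln (r s x)) has_vector_derivative pt T r t x / r t x) (at t within T)"
      using has_vector_derivative_pt[where F = r and x = x, OF r(1)] r(2)
      unfolding has_real_derivative_iff_has_vector_derivative[symmetric]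
      by (auto intro!: derivative_eq_intros simp: field_simps)
  qed (simp add: rh)
  from pt_eqI[where F = rh and x = x, OF T this] show ?thesis
    using r(2) by simp
qed

lemma pt_stereo:
  assumes T: "is_interval T" "interior T \<noteq> {}" "t \<in> T"
    and f: "(\<lambda>s. f s x) differentiable (at t within T)"
    and g: "(\<lambda>s. g s x) differentiable (at t within T)"
    and w: "\<And>s. s \<in> T \<Longrightarrow> w s x = stereo (f s x) (g s x)"
  shows "pt T w t x = pt T f t x *\<^sub>R stereo_phi (f t x) (g t x)
    + pt T g t x *\<^sub>R stereo_psi (f t x) (g t x)" (is "_ = ?D")
proof -
  have "((\<lambda>s. w s x) has_vector_derivative ?D) (at t within T)"
  proof (rule has_vector_derivative_transform[OF T(3)])
    show "((\<lambda>s. stereo (f s x) (g s x)) has_vector_derivative ?D) (at t within T)"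
      using has_derivative_stereo[OF
          has_vector_derivative_pt[where F = f and x = x, OF f, unfolded has_vector_derivative_def]
          has_vector_derivative_pt[where F = g and x = x, OF g, unfolded has_vector_derivative_def]]
      unfolding has_vector_derivative_def by (simp add: scaleR_add_right)
  qed (simp add: w)
  from pt_eqI[where F = w and x = x, OF T this] show ?thesis .
qed


section \<open>Equivalence of the two systems\<close>

theorem lemmaA1:
  fixes a b \<kappa> \<gamma> lam c1 c2 c4 Rey :: real
    and T :: "real set"
    and \<rho> rh \<phi> \<psi> p :: "real \<Rightarrow> real^3 \<Rightarrow> real"
    and \<Omega> v :: "real \<Rightarrow> real^3 \<Rightarrow> real^3"
  assumes kappa: "\<kappa> \<noteq> 0"
    and time_interval: "is_interval T" "interior T \<noteq> {}"
    and time_smooth: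
      "\<And>t x. t \<in> T \<Longrightarrow> (\<lambda>s. \<rho> s x) differentiable (at t within T)"
      "\<And>t x. t \<in> T \<Longrightarrow> (\<lambda>s. \<phi> s x) differentiable (at t within T)"
      "\<And>t x. t \<in> T \<Longrightarrow> (\<lambda>s. \<psi> s x) differentiable (at t within T)"
      "\<And>t x. t \<in> T \<Longrightarrow> (\<lambda>s. v s x) differentiable (at t within T)"
    and space_smooth:
      "\<And>t. t \<in> T \<Longrightarrow> twice_differentiable (\<rho> t)"
      "\<And>t. t \<in> T \<Longrightarrow> twice_differentiable (\<phi> t)"
      "\<And>t. t \<in> T \<Longrightarrow> twice_differentiable (\<psi> t)"
      "\<And>t. t \<in> T \<Longrightarrow> twice_differentiable (v t)"
      "\<And>t x. t \<in> T \<Longrightarrow> p t differentiable (at x)"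
    and rho_pos: "\<And>t x. t \<in> T \<Longrightarrow> \<rho> t x > 0"
    and rh: "\<And>t x. t \<in> T \<Longrightarrow> rh t x = ln (\<rho> t x)"
    and Omega: "\<And>t x. t \<in> T \<Longrightarrow> \<Omega> t x = stereo (\<phi> t x) (\<psi> t x)"
  shows "SOH_NS_solution a b \<kappa> \<gamma> lam c1 c2 c4 Rey T \<rho> \<Omega> v p
     \<longleftrightarrow> stereo_SOH_NS_solution a b \<kappa> \<gamma> lam c1 c2 c4 Rey T rh \<phi> \<psi> v p"
proof -
  have \<Omega>_eq: "\<Omega> t = (\<lambda>y. stereo (\<phi> t y) (\<psi> t y))" if "t \<in> T" for t
    by (simp add: fun_eq_iff Omega[OF that])
  have diff: "\<rho> t differentiable (at x)" "\<phi> t differentiable (at x)" "\<psi> t differentiable (at x)"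
    "v t differentiable (at x)" if "t \<in> T" for t x
    using space_smooth(1-4)[OF that] by (auto intro: twice_differentiableD)
  have grad_\<rho>: "grad (\<rho> t) x = \<rho> t x *\<^sub>R grad (rh t) x" if "t \<in> T" for t x
  proof -
    have "rh t = (\<lambda>y. ln (\<rho> t y))"
      by (simp add: fun_eq_iff rh[OF that])
    then show ?thesis
      using grad_ln[OF diff(1) rho_pos, OF that that] by simp
  qed
  have density: "pt T \<rho> t x + dvg (\<lambda>y. \<rho> t y *\<^sub>R transport a c1 (\<Omega> t y) (v t y)) x = 0 \<longleftrightarrow>
      pt T rh t x + transport a c1 (stereo (\<phi> t x) (\<psi> t x)) (v t x) \<bullet> grad (rh t) x
         + a * c1 * (stereo_phi (\<phi> t x) (\<psi> t x) \<bullet> grad (\<phi> t) x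
                     + stereo_psi (\<phi> t x) (\<psi> t x) \<bullet> grad (\<psi> t) x) = 0"
    if t: "t \<in> T" and incompressible: "dvg (v t) x = 0" for t x
  proof -
    have pt_\<rho>: "pt T \<rho> t x = \<rho> t x * pt T rh t x"
      by (intro pt_ln time_interval t time_smooth rho_pos rh)
    show ?thesis
      unfolding \<Omega>_eq[OF t] dvg_mass_flux[where rh = "rh t", OF diff[OF t] grad_\<rho>[OF t]]
        pt_\<rho> incompressible
      using rho_pos[OF t, of x] by (simp add: add.assoc flip: distrib_left)
  qed
  have orientation: "\<rho> t x *\<^sub>R pt T \<Omega> t x
         + \<rho> t x *\<^sub>R advect (transport a c2 (\<Omega> t x) (v t x)) (\<Omega> t) x
         + (a / \<kappa>) *\<^sub>R (proj_perp (\<Omega> t x) *v grad (\<rho> t) x)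
       = \<gamma> *\<^sub>R (proj_perp (\<Omega> t x) *v lapl (\<lambda>y. \<rho> t y *\<^sub>R \<Omega> t y) x)
         + \<rho> t x *\<^sub>R (proj_perp (\<Omega> t x) *v
             ((lam *\<^sub>R strain (v t) x + spin (v t) x) *v \<Omega> t x)) \<longleftrightarrow>
      pt T \<phi> t x + transport a c2 (stereo (\<phi> t x) (\<psi> t x)) (v t x) \<bullet> grad (\<phi> t) x
        + H_phi a \<kappa> \<gamma> lam (rh t) (\<phi> t) (\<psi> t) (v t) x = 0
    \<and> pt T \<psi> t x + transport a c2 (stereo (\<phi> t x) (\<psi> t x)) (v t x) \<bullet> grad (\<psi> t) x
        + H_psi a \<kappa> \<gamma> lam (rh t) (\<phi> t) (\<psi> t) (v t) x = 0" (is "?L = ?R \<longleftrightarrow> ?scalar")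
    if t: "t \<in> T" for t x
  proof -
    have pt_\<Omega>: "pt T \<Omega> t x = pt T \<phi> t x *\<^sub>R stereo_phi (\<phi> t x) (\<psi> t x)
        + pt T \<psi> t x *\<^sub>R stereo_psi (\<phi> t x) (\<psi> t x)"
      by (intro pt_stereo time_interval t time_smooth Omega)
    have "?L = ?R \<longleftrightarrow> ?L - ?R = 0"
      by simp
    also have "\<dots> \<longleftrightarrow> ?scalar"
      unfolding pt_\<Omega> unfolding \<Omega>_eq[OF t]
        orientation_defect[where rh = "rh t", OF space_smooth(1-3)[OF t] grad_\<rho>[OF t]]
      using rho_pos[OF t, of x] by (simp add: stereo_frame_independent)
    finally show ?thesis .
  qed
  have momentum: "Rey *\<^sub>R (pt T v t x + advect (v t x) (v t) x) + grad (p t) x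
       = lapl (v t) x - b *\<^sub>R dvg_mat (\<lambda>y. \<rho> t y *\<^sub>R Q_tensor c4 (\<Omega> t y)) x \<longleftrightarrow>
      Rey *\<^sub>R (pt T v t x + advect (v t x) (v t) x) - lapl (v t) x + grad (p t) x
         + (b * exp (rh t x)) *\<^sub>R G_vec c4 (rh t) (\<phi> t) (\<psi> t) x = 0"
    if t: "t \<in> T" for t x
    unfolding \<Omega>_eq[OF t] dvg_mat_Q_tensor[where rh = "rh t", OF diff(1-3)[OF t] grad_\<rho>[OF t]]
    using rho_pos[OF t, of x] by (auto simp: rh[OF t] algebra_simps eq_diff_eq add_eq_0_iff)
  have unit: "norm (\<Omega> t x) = 1" if "t \<in> T" for t x
    by (simp add: \<Omega>_eq[OF that] stereo_frame)
  show ?thesis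
    unfolding SOH_NS_solution_def stereo_SOH_NS_solution_def Let_def
    by (intro ball_cong refl all_cong1) (use density orientation momentum unit in blast)
qed

end
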